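(* Let $k\ge 1$. Let $\begin{bmatrix} M_0 & -c_0\\ r_0^T & 1\end{bmatrix}$ be a matrix in $\mathcal{M}_{k+1}\{-1,1\}$ whose determinant has the maximal absolute value $\Theta_{k+1}$, and let $N_0$ be a matrix in $\mathcal{M}_k\{-1,1\}$ whose determinant has the maximal absolute value $\Theta_k$, where $M_0$ is a square matrix of order $k$ and $c_0,r_0$ are column vectors of length $k$. Let $$v_0^T=\begin{bmatrix} r_0^T & r_0^T\end{bmatrix},\qquad \tilde c=\begin{bmatrix} c_0^T & c_0^T\end{bmatrix}^T,\qquad g_0(k,1)=\begin{bmatrix} M_0 & M_0\\ -N_0 & N_0\end{bmatrix}.$$ Then the design matrix $\begin{bmatrix} g_0(k,1) & -\tilde c\\ v_0^T & 1\end{bmatrix}$ is a d-optimal design in $\mathcal{G}_1(k,1)$. Furthermore, $$\left|\det\begin{bmatrix} g_0(k,1) & -\tilde c\\ v_0^T & 1\end{bmatrix}\right|=2^k\,\Theta_k\,\Theta_{k+1}.$$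
   Context: $1_m$ denotes the all-ones column vector of length $m$, and $*$ denotes the Schur (entrywise) product. For $m\ge 1$, $\mathcal{M}_m\{-1,1\}$ is the set of non-singular $m\times m$ matrices with entries in $\{-1,1\}$ whose first column is $1_m$, and $\Theta_m$ is the maximum of $|\det(M)|$ over $M\in\mathcal{M}_m\{-1,1\}$. $\mathcal{G}_1(k,1)$ is the set of saturated design matrices for the mean $F_0$, the main effects $F_1,\dots,F_k$, the two-factor interactions $F_{12},\dots,F_{1k}$ and one extra main effect $F_1^e$ in a two-level factorial experiment with $k+1$ factors. That is, it is the set of non-singular $(2k+1)\times(2k+1)$ matrices with entries in $\{-1,1\}$ whose columns are, in this order, $F_1,\dots,F_k,F_{11},F_{12},\dots,F_{1k},F_1^e$, where $F_{1j}=F_1*F_j$ for $1\le j\le k$ (so $F_{11}=F_0=1_{2k+1}$) and $F_1^e$ is an arbitrary $\{-1,1\}$-vector. A d-optimal design in $\mathcal{G}_1(k,1)$ is an element whose determinant has maximal absolute value among all elements of $\mathcal{G}_1(k,1)$. *)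

theory Defs
  imports "Jordan_Normal_Form.Determinant"
begin

text \<open>
  Indices are 0-based: the factor column \<open>F\<^sub>j\<close> is column \<open>j - 1\<close> of a design matrix.
\<close>

definition ones_vec :: "nat \<Rightarrow> real vec" where
  "ones_vec m = vec m (\<lambda>_. 1)"

definition schur_vec :: "real vec \<Rightarrow> real vec \<Rightarrow> real vec" where
  "schur_vec u v = vec (dim_vec u) (\<lambda>i. u $ i * v $ i)"

definition sign_mats :: "nat \<Rightarrow> real mat set" where
  "sign_mats m = {M \<in> carrier_mat m m. elements_mat M \<subseteq> {-1, 1} \<and> det M \<noteq> 0}"

definition M_set :: "nat \<Rightarrow> real mat set" where
  "M_set m = {M \<in> sign_mats m. col M 0 = ones_vec m}"

definition Theta :: "nat \<Rightarrow> real" where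
  "Theta m = Max ((\<lambda>M. \<bar>det M\<bar>) ` M_set m)"

text \<open>
  Column \<open>k + j\<close> is the interaction of \<open>F\<^sub>1\<close> with \<open>F\<close> of index \<open>j + 1\<close>; for \<open>j = 0\<close> it is the
  all-ones column of the mean, since the entries are \<open>\<plusminus>1\<close>. The last column, of index \<open>2 * k\<close>,
  is the unconstrained extra main effect.
\<close>

definition G1_set :: "nat \<Rightarrow> real mat set" where
  "G1_set k = {D \<in> sign_mats (2 * k + 1).
     \<forall>j<k. col D (k + j) = schur_vec (col D 0) (col D j)}"

definition d_optimal :: "real mat set \<Rightarrow> real mat \<Rightarrow> bool" where
  "d_optimal S D \<longleftrightarrow> D \<in> S \<and> (\<forall>E\<in>S. \<bar>det E\<bar> \<le> \<bar>det D\<bar>)"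

text \<open>\<open>bordered A c r\<close> has the block rows \<open>A, -c\<close> and \<open>r\<^sup>T, 1\<close>.\<close>

definition bordered :: "real mat \<Rightarrow> real vec \<Rightarrow> real vec \<Rightarrow> real mat" where
  "bordered A c r =
     four_block_mat A (mat_of_cols (dim_vec c) [- c]) (mat_of_row r) (1\<^sub>m 1)"

end

theory Submission
  imports Defs
begin

text \<open>
  Every row of a design is \<open>(t * x\<^sub>1, \<dots>, t * x\<^sub>k, x\<^sub>1, \<dots>, x\<^sub>k, y)\<close>, where \<open>t\<close> is its entry in
  the column of \<open>F\<^sub>1\<close> and \<open>x\<^sub>1 = 1\<close>. Some sign \<open>- s\<close> is the value of \<open>t\<close> in at least \<open>k + 1\<close> rows;
  move \<open>k + 1\<close> of these to the bottom. Adding the interaction columns to \<open>s\<close> times the main effects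
  kills the lower left block and multiplies each of the other \<open>k\<close> rows \<open>(x\<^sub>1, \<dots>, x\<^sub>k)\<close> by
  \<open>1 + s * t\<close>, which is \<open>0\<close> or \<open>2\<close>. So the determinant is at most \<open>2 ^ k\<close> times that of a matrix in
  \<open>M_set k\<close> times that of one in \<open>M_set (k + 1)\<close>. These two matrices can be prescribed,
  with \<open>1 + s * t = 2\<close> in the upper rows, which makes the bound sharp.
\<close>

definition square_block :: "nat \<Rightarrow> nat \<Rightarrow> nat \<Rightarrow> 'a mat \<Rightarrow> 'a mat" where
  "square_block m a b A = mat m m (\<lambda>(i, j). A $$ (a + i, b + j))"

lemma square_block_carrier [simp]: "square_block m a b A \<in> carrier_mat m m"
  by (simp add: square_block_def)

lemma dim_square_block [simp]:
  "dim_row (square_block m a b A) = m" "dim_col (square_block m a b A) = m"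
  by (simp_all add: square_block_def)

lemma index_square_block [simp]:
  "i < m \<Longrightarrow> j < m \<Longrightarrow> square_block m a b A $$ (i, j) = A $$ (a + i, b + j)"
  by (simp add: square_block_def)

lemma det_mat_diag:
  fixes f :: "nat \<Rightarrow> 'a :: comm_ring_1"
  shows "det (mat_diag n f) = (\<Prod>i<n. f i)"
proof -
  have "det (mat_diag n f) = prod_list (diag_mat (mat_diag n f))"
    by (rule det_lower_triangular[where n = n]) (auto simp: mat_diag_def)
  then show ?thesis
    by (simp add: prod_list_diag_prod mat_diag_def lessThan_atLeast0)
qed

lemma mult_mat_truncated_identity:
  fixes A :: "'a :: semiring_1 mat"
  assumes A: "A \<in> carrier_mat r m" and "n \<le> m"
  shows "A * mat m n (\<lambda>(i, j). if i = j then 1 else 0) = mat r n (\<lambda>(i, j). A $$ (i, j))"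
proof (rule eq_matI)
  let ?I = "mat m n (\<lambda>(i, j). if i = j then 1 else 0 :: 'a)"
  fix i j assume "i < dim_row (mat r n (\<lambda>(i, j). A $$ (i, j)))"
    and "j < dim_col (mat r n (\<lambda>(i, j). A $$ (i, j)))"
  then have ij: "i < r" "j < n" by simp_all
  have "col ?I j = unit_vec m j"
    using ij \<open>n \<le> m\<close> by (intro eq_vecI) auto
  then have "(A * ?I) $$ (i, j) = row A i \<bullet> unit_vec m j"
    using A ij by simp
  also have "\<dots> = A $$ (i, j)"
    using A ij \<open>n \<le> m\<close> by simp
  finally show "(A * ?I) $$ (i, j) = mat r n (\<lambda>(i, j). A $$ (i, j)) $$ (i, j)"
    using ij by simp
qed (use A in auto)

lemma det_four_block_mat_combine_columns:
  fixes A B C E P :: "'a :: idom mat"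
  assumes A: "A \<in> carrier_mat n n" and B: "B \<in> carrier_mat n m"
    and C: "C \<in> carrier_mat m n" and E: "E \<in> carrier_mat m m" and P: "P \<in> carrier_mat m n"
  shows "s ^ n * det (four_block_mat A B C E)
    = det (four_block_mat (s \<cdot>\<^sub>m A + B * P) B (s \<cdot>\<^sub>m C + E * P) E)"
proof -
  define R where "R = four_block_mat (s \<cdot>\<^sub>m 1\<^sub>m n) (0\<^sub>m n m) P (1\<^sub>m m)"
  have scale: "X * (s \<cdot>\<^sub>m 1\<^sub>m n) = s \<cdot>\<^sub>m X" if "X \<in> carrier_mat r n" for X r
    using that by (simp add: mult_smult_distrib[OF that one_carrier_mat])
  have "four_block_mat A B C E * R =
      four_block_mat (A * (s \<cdot>\<^sub>m 1\<^sub>m n) + B * P) (A * 0\<^sub>m n m + B * 1\<^sub>m m)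
        (C * (s \<cdot>\<^sub>m 1\<^sub>m n) + E * P) (C * 0\<^sub>m n m + E * 1\<^sub>m m)"
    unfolding R_def by (rule mult_four_block_mat[OF A B C E _ _ P]) auto
  also have "\<dots> = four_block_mat (s \<cdot>\<^sub>m A + B * P) B (s \<cdot>\<^sub>m C + E * P) E"
    using A B C E by (simp add: scale[OF A] scale[OF C])
  finally have "det (four_block_mat A B C E) * det R
      = det (four_block_mat (s \<cdot>\<^sub>m A + B * P) B (s \<cdot>\<^sub>m C + E * P) E)"
    using A E P by (subst det_mult[where n = "n + m", symmetric]) (auto simp: R_def)
  moreover have "det R = s ^ n"
    unfolding R_def using P
    by (subst det_four_block_mat_upper_right_zero[where n = n and m = m]) auto
  ultimately show ?thesis
    by (simp add: mult.commute)
qed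

lemma det_eliminate_lower_left:
  fixes D :: "'a :: idom mat"
  assumes D: "D \<in> carrier_mat (n + m) (n + m)" and "n \<le> m"
    and lower: "\<And>i j. n \<le> i \<Longrightarrow> i < n + m \<Longrightarrow> j < n \<Longrightarrow> s * D $$ (i, j) + D $$ (i, n + j) = 0"
  shows "s ^ n * det D
    = det (s \<cdot>\<^sub>m square_block n 0 0 D + square_block n 0 n D) * det (square_block m n n D)"
proof -
  let ?A = "square_block n 0 0 D" and ?E = "square_block m n n D"
  let ?B = "mat n m (\<lambda>(i, j). D $$ (i, n + j))" and ?C = "mat m n (\<lambda>(i, j). D $$ (n + i, j))"
  let ?P = "mat m n (\<lambda>(i, j). if i = j then 1 else 0 :: 'a)"
  have "D = four_block_mat ?A ?B ?C ?E"
    using D by (intro eq_matI) auto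
  then have "s ^ n * det D = det (four_block_mat (s \<cdot>\<^sub>m ?A + ?B * ?P) ?B (s \<cdot>\<^sub>m ?C + ?E * ?P) ?E)"
    using det_four_block_mat_combine_columns[of ?A n ?B m ?C ?E ?P s] by simp
  also have "?B * ?P = square_block n 0 n D"
    using \<open>n \<le> m\<close> by (subst mult_mat_truncated_identity[of _ n]) auto
  also have "s \<cdot>\<^sub>m ?C + ?E * ?P = 0\<^sub>m m n"
    using \<open>n \<le> m\<close> lower by (subst mult_mat_truncated_identity[of _ m]) auto
  also have "det (four_block_mat (s \<cdot>\<^sub>m ?A + square_block n 0 n D) ?B (0\<^sub>m m n) ?E)
      = det (s \<cdot>\<^sub>m ?A + square_block n 0 n D) * det ?E"
    by (rule det_four_block_mat_lower_left_zero[where n = n and m = m]) auto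
  finally show ?thesis .
qed

lemma det_proportional_left_block:
  fixes D :: "'a :: idom mat"
  assumes D: "D \<in> carrier_mat (n + m) (n + m)" and "n \<le> m"
    and rows: "\<And>i j. i < n + m \<Longrightarrow> j < n \<Longrightarrow> D $$ (i, j) = \<sigma> i * D $$ (i, n + j)"
    and lower: "\<And>i. n \<le> i \<Longrightarrow> i < n + m \<Longrightarrow> s * \<sigma> i = - 1"
  shows "s ^ n * det D
    = (\<Prod>i<n. 1 + s * \<sigma> i) * det (square_block n 0 n D) * det (square_block m n n D)"
proof -
  have combine: "s * D $$ (i, j) + D $$ (i, n + j) = (1 + s * \<sigma> i) * D $$ (i, n + j)"
    if "i < n + m" "j < n" for i j
    using rows[OF that] by (simp add: algebra_simps)
  have "s \<cdot>\<^sub>m square_block n 0 0 D + square_block n 0 n D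
      = mat_diag n (\<lambda>i. 1 + s * \<sigma> i) * square_block n 0 n D"
    by (subst mat_diag_mult_left[where n = n and nr = n])
      (auto simp: square_block_def combine intro!: eq_matI)
  then have "det (s \<cdot>\<^sub>m square_block n 0 0 D + square_block n 0 n D)
      = (\<Prod>i<n. 1 + s * \<sigma> i) * det (square_block n 0 n D)"
    by (simp add: det_mult[where n = n] det_mat_diag)
  moreover have "s * D $$ (i, j) + D $$ (i, n + j) = 0" if "n \<le> i" "i < n + m" "j < n" for i j
    using combine[of i j] lower[of i] that by simp
  ultimately show ?thesis
    using det_eliminate_lower_left[OF D \<open>n \<le> m\<close>] by simp
qed

definition permute_rows :: "(nat \<Rightarrow> nat) \<Rightarrow> 'a mat \<Rightarrow> 'a mat" where
  "permute_rows p A = mat (dim_row A) (dim_col A) (\<lambda>(i, j). A $$ (p i, j))"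

lemma abs_det_permute_rows:
  fixes A :: "'a :: linordered_idom mat"
  assumes "A \<in> carrier_mat n n" "p permutes {0..<n}"
  shows "\<bar>det (permute_rows p A)\<bar> = \<bar>det A\<bar>"
  using det_permute_rows[OF assms] assms(1) by (auto simp: permute_rows_def abs_mult sign_def)

lemma ex_permutes_image_eq:
  assumes "finite S" "A \<subseteq> S" "B \<subseteq> S" "card A = card B"
  shows "\<exists>p. p permutes S \<and> p ` A = B"
proof -
  have fin: "finite A" "finite B"
    using assms finite_subset by auto
  obtain f where f: "bij_betw f A B"
    using finite_same_card_bij[OF fin assms(4)] by blast
  have "card (S - A) = card (S - B)"
    using assms fin by (simp add: card_Diff_subset)
  then obtain g where g: "bij_betw g (S - A) (S - B)"
    using finite_same_card_bij[of "S - A" "S - B"] assms(1) by auto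
  define q where "q x = (if x \<in> A then f x else g x)" for x
  define p where "p x = (if x \<in> S then q x else x)" for x
  have "bij_betw q (A \<union> (S - A)) (B \<union> (S - B))"
    unfolding q_def using f g by (intro bij_betw_disjoint_Un) auto
  then have "bij_betw q S S"
    using assms(2,3) by (simp add: Un_absorb1)
  then have "bij_betw p S S"
    by (rule bij_betw_cong[THEN iffD1, rotated]) (simp add: p_def)
  then have "p permutes S"
    by (rule bij_imp_permutes) (simp add: p_def)
  moreover have "p ` A = f ` A"
    using assms(2) by (intro image_cong) (auto simp: p_def q_def)
  ultimately show ?thesis
    using bij_betw_imp_surj_on[OF f] by blast
qed

lemma ex_permutes_constant_tail:
  fixes k :: nat
  assumes "\<And>i. i < 2 * k + 1 \<Longrightarrow> f i \<in> {a, b}"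
  shows "\<exists>p c. p permutes {0..<2 * k + 1} \<and> c \<in> {a, b} \<and> (\<forall>i\<in>{k..<2 * k + 1}. f (p i) = c)"
proof -
  let ?S = "{0..<2 * k + 1}"
  define fiber where "fiber c = {i \<in> ?S. f i = c}" for c
  have "fiber a \<union> fiber b = ?S"
    using assms by (fastforce simp: fiber_def)
  then have "2 * k + 1 \<le> card (fiber a) + card (fiber b)"
    using card_Un_le[of "fiber a" "fiber b"] by simp
  then have "k + 1 \<le> card (fiber a) \<or> k + 1 \<le> card (fiber b)"
    by linarith
  then obtain c where c: "c \<in> {a, b}" "k + 1 \<le> card (fiber c)"
    by blast
  obtain T where T: "T \<subseteq> fiber c" "card T = k + 1"
    using obtain_subset_with_card_n[OF c(2)] by blast
  have "\<exists>p. p permutes ?S \<and> p ` {k..<2 * k + 1} = T"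
    by (rule ex_permutes_image_eq) (use T in \<open>auto simp: fiber_def\<close>)
  then obtain p where "p permutes ?S" "p ` {k..<2 * k + 1} = T"
    by blast
  moreover from this(2) T(1) have "\<forall>i\<in>{k..<2 * k + 1}. f (p i) = c"
    by (auto simp: fiber_def)
  ultimately show ?thesis
    using c(1) by blast
qed

lemma elements_mat_subset_iff:
  assumes "A \<in> carrier_mat m n"
  shows "elements_mat A \<subseteq> S \<longleftrightarrow> (\<forall>i<m. \<forall>j<n. A $$ (i, j) \<in> S)"
  using assms by (auto dest!: elements_matD)

lemma finite_mats_elements_subset:
  assumes "finite S"
  shows "finite {A \<in> carrier_mat m n. elements_mat A \<subseteq> S}"
proof (rule finite_subset)
  let ?I = "{0..<m} \<times> {0..<n}"
  show "{A \<in> carrier_mat m n. elements_mat A \<subseteq> S} \<subseteq> mat m n ` (?I \<rightarrow>\<^sub>E S)"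
  proof
    fix A assume A: "A \<in> {A \<in> carrier_mat m n. elements_mat A \<subseteq> S}"
    then have "A = mat m n (restrict (\<lambda>ij. A $$ ij) ?I)"
      by (intro eq_matI) auto
    moreover have "restrict (\<lambda>ij. A $$ ij) ?I \<in> ?I \<rightarrow>\<^sub>E S"
      using A elements_mat_subset_iff[of A m n S] by auto
    ultimately show "A \<in> mat m n ` (?I \<rightarrow>\<^sub>E S)"
      by blast
  qed
  show "finite (mat m n ` (?I \<rightarrow>\<^sub>E S))"
    using assms by (intro finite_imageI finite_PiE) auto
qed

lemma M_set_iff:
  "M \<in> M_set m \<longleftrightarrow> M \<in> carrier_mat m m \<and> det M \<noteq> 0
     \<and> (\<forall>i<m. M $$ (i, 0) = 1 \<and> (\<forall>j<m. M $$ (i, j) \<in> {-1, 1}))"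
proof (cases "M \<in> carrier_mat m m")
  case True
  have "col M 0 = ones_vec m \<longleftrightarrow> (\<forall>i<m. M $$ (i, 0) = 1)"
    using True by (cases "m = 0") (auto simp: vec_eq_iff ones_vec_def)
  then show ?thesis
    using elements_mat_subset_iff[OF True, of "{-1, 1}"] True
    unfolding M_set_def sign_mats_def by auto
qed (simp add: M_set_def sign_mats_def)

lemma abs_det_le_Theta:
  assumes "M \<in> M_set m"
  shows "\<bar>det M\<bar> \<le> Theta m"
proof -
  have "finite (M_set m)"
    by (rule finite_subset[OF _ finite_mats_elements_subset[of "{-1, 1}" m m]])
      (auto simp: M_set_def sign_mats_def)
  then show ?thesis
    unfolding Theta_def using assms by (intro Max_ge) auto
qed

lemma interaction_row_iff:
  fixes x :: "nat \<Rightarrow> real"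
  assumes "k \<ge> 1"
  shows "(\<forall>j<2 * k + 1. x j \<in> {-1, 1}) \<and> (\<forall>j<k. x (k + j) = x 0 * x j)
    \<longleftrightarrow> x 0 \<in> {-1, 1} \<and> x k = 1 \<and> (\<forall>j<k + 1. x (k + j) \<in> {-1, 1})
      \<and> (\<forall>j<k. x 0 * x (k + j) = x j)"
    (is "?signs \<and> ?interactions \<longleftrightarrow> ?head \<and> ?mean \<and> ?tail_signs \<and> ?main_effects")
proof
  assume "?signs \<and> ?interactions"
  then have signs: "\<And>j. j < 2 * k + 1 \<Longrightarrow> x j \<in> {-1, 1}"
    and interactions: "\<And>j. j < k \<Longrightarrow> x (k + j) = x 0 * x j"
    by blast+
  have square: "x 0 * x 0 = 1"
    using signs[of 0] by auto
  have ?mean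
    using interactions[of 0] square assms by simp
  moreover have ?main_effects
    using interactions square by (simp flip: mult.assoc)
  moreover have ?head ?tail_signs
    using signs by simp_all
  ultimately show "?head \<and> ?mean \<and> ?tail_signs \<and> ?main_effects"
    by blast
next
  assume "?head \<and> ?mean \<and> ?tail_signs \<and> ?main_effects"
  then have head: ?head and tail_signs: "\<And>j. j < k + 1 \<Longrightarrow> x (k + j) \<in> {-1, 1}"
    and main_effects: "\<And>j. j < k \<Longrightarrow> x 0 * x (k + j) = x j"
    by blast+
  have ?interactions
  proof (intro allI impI)
    fix j assume "j < k"
    then show "x (k + j) = x 0 * x j"
      using head main_effects[of j] by auto
  qed
  moreover have "x j \<in> {-1, 1}" if "j < 2 * k + 1" for j
  proof (cases "j < k")
    case True
    then show ?thesis
      using head main_effects[of j] tail_signs[of j] by auto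
  next
    case False
    then show ?thesis
      using tail_signs[of "j - k"] that by simp
  qed
  ultimately show "?signs \<and> ?interactions"
    by blast
qed

lemma G1_set_iff:
  assumes "k \<ge> 1"
  shows "D \<in> G1_set k \<longleftrightarrow> D \<in> carrier_mat (2 * k + 1) (2 * k + 1) \<and> det D \<noteq> 0
    \<and> (\<forall>i<2 * k + 1. D $$ (i, 0) \<in> {-1, 1} \<and> D $$ (i, k) = 1
      \<and> (\<forall>j<k + 1. D $$ (i, k + j) \<in> {-1, 1})
      \<and> (\<forall>j<k. D $$ (i, 0) * D $$ (i, k + j) = D $$ (i, j)))"
proof (cases "D \<in> carrier_mat (2 * k + 1) (2 * k + 1)")
  case True
  have "(\<forall>j<k. col D (k + j) = schur_vec (col D 0) (col D j)) \<longleftrightarrow>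
    (\<forall>i<2 * k + 1. \<forall>j<k. D $$ (i, k + j) = D $$ (i, 0) * D $$ (i, j))"
    using True by (auto simp: vec_eq_iff schur_vec_def)
  then have "D \<in> G1_set k \<longleftrightarrow> det D \<noteq> 0 \<and> (\<forall>i<2 * k + 1.
      (\<forall>j<2 * k + 1. D $$ (i, j) \<in> {-1, 1}) \<and> (\<forall>j<k. D $$ (i, k + j) = D $$ (i, 0) * D $$ (i, j)))"
    using elements_mat_subset_iff[OF True, of "{-1, 1}"] True
    unfolding G1_set_def sign_mats_def by blast
  then show ?thesis
    using True interaction_row_iff[OF assms, of "\<lambda>j. D $$ (i, j)" for i] by simp
qed (simp add: G1_set_def sign_mats_def)

lemma permute_rows_in_G1_set:
  assumes "k \<ge> 1" and D: "D \<in> G1_set k" and p: "p permutes {0..<2 * k + 1}"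
  shows "permute_rows p D \<in> G1_set k"
proof -
  have carrier: "D \<in> carrier_mat (2 * k + 1) (2 * k + 1)" and "det D \<noteq> 0"
    using D by (simp_all add: G1_set_iff[OF \<open>k \<ge> 1\<close>])
  then have "det (permute_rows p D) \<noteq> 0"
    using abs_det_permute_rows[OF carrier p] by auto
  moreover have "p i < 2 * k + 1" if "i < 2 * k + 1" for i
    using permutes_in_image[OF p, of i] that by simp
  ultimately show ?thesis
    using D by (simp add: G1_set_iff[OF \<open>k \<ge> 1\<close>] permute_rows_def carrier_matD[OF carrier])
qed

lemma square_block_in_M_set:
  assumes "k \<ge> 1" "D \<in> G1_set k" "a + m \<le> 2 * k + 1" "m \<le> k + 1"
    and "det (square_block m a k D) \<noteq> 0"
  shows "square_block m a k D \<in> M_set m"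
  using assms by (cases "m = 0") (auto simp: M_set_iff G1_set_iff)

lemma G1_set_abs_det_le_if_constant_tail:
  assumes "k \<ge> 1" and D: "D \<in> G1_set k" and "t \<in> {-1, 1}"
    and tail: "\<And>i. k \<le> i \<Longrightarrow> i < 2 * k + 1 \<Longrightarrow> D $$ (i, 0) = t"
  shows "\<bar>det D\<bar> \<le> 2 ^ k * Theta k * Theta (k + 1)"
proof -
  let ?U = "square_block k 0 k D" and ?L = "square_block (k + 1) k k D"
  have "(- t) ^ k * det D = (\<Prod>i<k. 1 + - t * D $$ (i, 0)) * det ?U * det ?L"
    using D \<open>t \<in> {-1, 1}\<close> tail
    by (intro det_proportional_left_block) (auto simp: G1_set_iff[OF \<open>k \<ge> 1\<close>] mult_2)
  then have "\<bar>(- t) ^ k * det D\<bar> = \<bar>(\<Prod>i<k. 1 + - t * D $$ (i, 0)) * det ?U * det ?L\<bar>"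
    by simp
  then have abs_det_D: "\<bar>det D\<bar> = (\<Prod>i<k. \<bar>1 - t * D $$ (i, 0)\<bar>) * \<bar>det ?U\<bar> * \<bar>det ?L\<bar>"
    using \<open>t \<in> {-1, 1}\<close> by (auto simp: abs_mult abs_prod power_abs)
  moreover have "det D \<noteq> 0"
    using D by (simp add: G1_set_iff[OF \<open>k \<ge> 1\<close>])
  ultimately have "det ?U \<noteq> 0" "det ?L \<noteq> 0"
    by auto
  then have upper: "\<bar>det ?U\<bar> \<le> Theta k" and lower: "\<bar>det ?L\<bar> \<le> Theta (k + 1)"
    using square_block_in_M_set[OF \<open>k \<ge> 1\<close> D] by (auto intro!: abs_det_le_Theta)
  have "\<bar>1 - t * D $$ (i, 0)\<bar> \<le> 2" if "i < k" for i
  proof -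
    have "D $$ (i, 0) \<in> {-1, 1}"
      using D that by (simp add: G1_set_iff[OF \<open>k \<ge> 1\<close>])
    then show ?thesis
      using \<open>t \<in> {-1, 1}\<close> by auto
  qed
  then have "(\<Prod>i<k. \<bar>1 - t * D $$ (i, 0)\<bar>) \<le> (\<Prod>i<k. 2)"
    by (intro prod_mono) auto
  moreover have "0 \<le> Theta k"
    using upper by (rule order_trans[rotated]) simp
  ultimately show ?thesis
    unfolding abs_det_D using upper lower by (intro mult_mono) auto
qed

lemma G1_set_abs_det_le:
  assumes "k \<ge> 1" and D: "D \<in> G1_set k"
  shows "\<bar>det D\<bar> \<le> 2 ^ k * Theta k * Theta (k + 1)"
proof -
  have carrier: "D \<in> carrier_mat (2 * k + 1) (2 * k + 1)"
    and signs: "\<And>i. i < 2 * k + 1 \<Longrightarrow> D $$ (i, 0) \<in> {-1, 1}"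
    using D unfolding G1_set_iff[OF \<open>k \<ge> 1\<close>] by blast+
  obtain p t where p: "p permutes {0..<2 * k + 1}" and t: "t \<in> {-1, 1}"
    and tail: "\<forall>i\<in>{k..<2 * k + 1}. D $$ (p i, 0) = t"
    using ex_permutes_constant_tail[where f = "\<lambda>i. D $$ (i, 0)", OF signs] by blast
  have "permute_rows p D $$ (i, 0) = t" if "k \<le> i" "i < 2 * k + 1" for i
    using carrier tail that by (simp add: permute_rows_def)
  then have "\<bar>det (permute_rows p D)\<bar> \<le> 2 ^ k * Theta k * Theta (k + 1)"
    by (rule G1_set_abs_det_le_if_constant_tail
        [OF \<open>k \<ge> 1\<close> permute_rows_in_G1_set[OF \<open>k \<ge> 1\<close> D p] t])
  then show ?thesis
    by (simp add: abs_det_permute_rows[OF carrier p])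
qed

lemma bordered_carrier:
  assumes "A \<in> carrier_mat n n" "c \<in> carrier_vec n" "r \<in> carrier_vec n"
  shows "bordered A c r \<in> carrier_mat (n + 1) (n + 1)"
  using assms by (auto simp: bordered_def)

lemma index_bordered:
  assumes "A \<in> carrier_mat n n" "c \<in> carrier_vec n" "r \<in> carrier_vec n"
    and "i < n + 1" "j < n + 1"
  shows "bordered A c r $$ (i, j) = (if i < n then if j < n then A $$ (i, j) else - (c $ i)
    else if j < n then r $ j else 1)"
  using assms by (auto simp: bordered_def mat_of_cols_index mat_of_row_def)

definition doubled_design :: "real mat \<Rightarrow> real mat \<Rightarrow> real vec \<Rightarrow> real vec \<Rightarrow> real mat" where
  "doubled_design M N c r = bordered (four_block_mat M M (- N) N) (c @\<^sub>v c) (r @\<^sub>v r)"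

context
  fixes k :: nat and M N :: "real mat" and c r :: "real vec"
  assumes carriers: "M \<in> carrier_mat k k" "N \<in> carrier_mat k k"
    "c \<in> carrier_vec k" "r \<in> carrier_vec k"
begin

lemma doubled_design_carrier: "doubled_design M N c r \<in> carrier_mat (2 * k + 1) (2 * k + 1)"
  unfolding doubled_design_def using carriers by (intro bordered_carrier) (auto simp: mult_2)

lemma index_doubled_design:
  assumes "i < 2 * k + 1" "j < 2 * k + 1"
  shows "doubled_design M N c r $$ (i, j) =
    (if i < 2 * k
     then if j < 2 * k then four_block_mat M M (- N) N $$ (i, j) else - ((c @\<^sub>v c) $ i)
     else if j < 2 * k then (r @\<^sub>v r) $ j else 1)"
  unfolding doubled_design_def using assms carriers by (intro index_bordered) (auto simp: mult_2)

lemma index_doubled_design_right: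
  assumes "i < 2 * k + 1" "j < k + 1"
  shows "doubled_design M N c r $$ (i, k + j) =
    (if i < k then bordered M c r $$ (i, j)
     else if i < 2 * k then bordered N c r $$ (i - k, j)
     else bordered M c r $$ (k, j))"
  using assms carriers by (auto simp: index_doubled_design index_bordered)

lemma index_doubled_design_left:
  assumes "i < 2 * k + 1" "j < k"
  shows "doubled_design M N c r $$ (i, j) =
    (if k \<le> i \<and> i < 2 * k then -1 else 1) * doubled_design M N c r $$ (i, k + j)"
  using assms carriers by (auto simp: index_doubled_design)

lemma abs_det_doubled_design:
  "\<bar>det (doubled_design M N c r)\<bar> = 2 ^ k * \<bar>det N\<bar> * \<bar>det (bordered M c r)\<bar>"
proof -
  let ?D = "doubled_design M N c r"
  define swap where "swap i = (if i < k then i + k else if i < k + k then i - k else i)" for i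
  define S where "S = mat (2 * k + 1) (2 * k + 1) (\<lambda>(i, j). ?D $$ (swap i, j))"
  have abs_det_S: "\<bar>det ?D\<bar> = \<bar>det S\<bar>"
    unfolding S_def swap_def using det_swap_initial_rows[OF doubled_design_carrier, of k k]
    by (simp add: abs_mult power_abs)
  have swap: "swap i < 2 * k + 1" "k \<le> swap i \<and> swap i < 2 * k \<longleftrightarrow> i < k" if "i < 2 * k + 1" for i
    using that by (auto simp: swap_def)
  have S: "S \<in> carrier_mat (k + (k + 1)) (k + (k + 1))"
    by (simp add: S_def mult_2)
  have rows: "S $$ (i, j) = (if i < k then -1 else 1) * S $$ (i, k + j)"
    if "i < k + (k + 1)" "j < k" for i j
    using that index_doubled_design_left[of "swap i" j] swap[of i] by (simp add: S_def)
  have "(-1) ^ k * det S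
      = (\<Prod>i<k. 1 + -1 * (if i < k then -1 else 1)) * det (square_block k 0 k S)
        * det (square_block (k + 1) k k S)"
    by (rule det_proportional_left_block[OF S _ rows]) simp_all
  also have "square_block k 0 k S = N"
  proof (rule eq_matI)
    fix i j assume "i < dim_row N" "j < dim_col N"
    then show "square_block k 0 k S $$ (i, j) = N $$ (i, j)"
      using carriers index_doubled_design_right[of "i + k" j]
      by (simp add: S_def swap_def index_bordered)
  qed (use carriers in auto)
  also have "square_block (k + 1) k k S = bordered M c r"
  proof (rule eq_matI)
    fix i j assume "i < dim_row (bordered M c r)" "j < dim_col (bordered M c r)"
    then have "i < k + 1" "j < k + 1"
      using bordered_carrier[of M k c r] carriers by auto
    then show "square_block (k + 1) k k S $$ (i, j) = bordered M c r $$ (i, j)"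
      using index_doubled_design_right[of "swap (k + i)" j]
      by (auto simp: S_def swap_def less_Suc_eq)
  qed (use bordered_carrier[of M k c r] carriers in auto)
  finally have "\<bar>(-1) ^ k * det S\<bar> = \<bar>2 ^ k * det N * det (bordered M c r)\<bar>"
    by simp
  then show ?thesis
    by (simp add: abs_det_S abs_mult power_abs)
qed

lemma doubled_design_in_G1_set:
  assumes "k \<ge> 1" and M: "bordered M c r \<in> M_set (k + 1)" and N: "N \<in> M_set k"
  shows "doubled_design M N c r \<in> G1_set k"
proof -
  let ?D = "doubled_design M N c r"
  have M_signs: "bordered M c r $$ (i, j) \<in> {-1, 1}" if "i < k + 1" "j < k + 1" for i j
    using M that by (simp add: M_set_iff)
  have N_signs: "bordered N c r $$ (i, j) \<in> {-1, 1}" if "i < k" "j < k + 1" for i j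
    using N M_signs[of i k] that carriers by (cases "j < k") (auto simp: M_set_iff index_bordered)
  have right: "?D $$ (i, k + j) \<in> {-1, 1}" if "i < 2 * k + 1" "j < k + 1" for i j
    using that M_signs[of i j] N_signs[of "i - k" j] M_signs[of k j]
    by (simp add: index_doubled_design_right)
  have mean: "?D $$ (i, k) = 1" if "i < 2 * k + 1" for i
  proof -
    have "bordered M c r $$ (i, 0) = 1" if "i < k + 1" for i
      using M that by (simp add: M_set_iff)
    moreover have "bordered N c r $$ (i, 0) = 1" if "i < k" for i
      using N that carriers by (simp add: M_set_iff index_bordered)
    ultimately show ?thesis
      using index_doubled_design_right[OF that, of 0] that by simp
  qed
  have head: "?D $$ (i, 0) = (if k \<le> i \<and> i < 2 * k then -1 else 1)" if "i < 2 * k + 1" for i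
    using index_doubled_design_left[OF that, of 0] mean[OF that] \<open>k \<ge> 1\<close> by simp
  have "det ?D \<noteq> 0"
    using abs_det_doubled_design M N by (auto simp: M_set_iff)
  then show ?thesis
    unfolding G1_set_iff[OF \<open>k \<ge> 1\<close>]
    using doubled_design_carrier right mean head index_doubled_design_left by simp
qed

end

theorem corollary3:
  fixes k :: nat and M\<^sub>0 N\<^sub>0 g\<^sub>0 :: "real mat" and c\<^sub>0 r\<^sub>0 v\<^sub>0 c' :: "real vec"
  assumes "k \<ge> 1"
    and "M\<^sub>0 \<in> carrier_mat k k" and "c\<^sub>0 \<in> carrier_vec k" and "r\<^sub>0 \<in> carrier_vec k"
    and "bordered M\<^sub>0 c\<^sub>0 r\<^sub>0 \<in> M_set (k + 1)"
    and "\<bar>det (bordered M\<^sub>0 c\<^sub>0 r\<^sub>0)\<bar> = Theta (k + 1)"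
    and "N\<^sub>0 \<in> M_set k" and "\<bar>det N\<^sub>0\<bar> = Theta k"
    and "v\<^sub>0 = r\<^sub>0 @\<^sub>v r\<^sub>0"
    and "c' = c\<^sub>0 @\<^sub>v c\<^sub>0"
    and "g\<^sub>0 = four_block_mat M\<^sub>0 M\<^sub>0 (- N\<^sub>0) N\<^sub>0"
  shows "d_optimal (G1_set k) (bordered g\<^sub>0 c' v\<^sub>0)
    \<and> \<bar>det (bordered g\<^sub>0 c' v\<^sub>0)\<bar> = 2 ^ k * Theta k * Theta (k + 1)"
proof -
  have design: "bordered g\<^sub>0 c' v\<^sub>0 = doubled_design M\<^sub>0 N\<^sub>0 c\<^sub>0 r\<^sub>0"
    unfolding doubled_design_def assms(9-11) ..
  have "N\<^sub>0 \<in> carrier_mat k k"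
    using \<open>N\<^sub>0 \<in> M_set k\<close> by (simp add: M_set_iff)
  note carriers = assms(2) this assms(3,4)
  have det: "\<bar>det (bordered g\<^sub>0 c' v\<^sub>0)\<bar> = 2 ^ k * Theta k * Theta (k + 1)"
    unfolding design abs_det_doubled_design[OF carriers] assms(6,8) ..
  have "bordered g\<^sub>0 c' v\<^sub>0 \<in> G1_set k"
    unfolding design by (rule doubled_design_in_G1_set[OF carriers assms(1,5,7)])
  then have "d_optimal (G1_set k) (bordered g\<^sub>0 c' v\<^sub>0)"
    unfolding d_optimal_def det using G1_set_abs_det_le[OF \<open>k \<ge> 1\<close>] by blast
  with det show ?thesis
    by blast
qed

end
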